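(* Let $V$ be a finite set and let $L\subseteq 2^V$ be upwards closed. A simplicial complex on $V$ generates $L$ if and only if its $1$-skeleton is $L$-connected. In other words, the minimal complexes generating $L$ are the minimal $L$-connected graphs on $V$ (minimality being with respect to inclusion).
   Context: All sets are finite. For $f:B^J\to A^I$ write $f_i(x)=f(x)_i$. For $i\in I$, the input window $\mathcal{W}_f(i)$ is the smallest set $W\subseteq J$ (it exists) such that for all $x,y\in B^J$, $x|_W=y|_W$ implies $f_i(x)=f_i(y)$. A simplicial complex (or complex) over (or on) a set $I$ is a collection of subsets of $I$, called its simplices, that is closed under taking subsets. The communication complex $K_f$ of $f$ is the complex over $I$ defined, for $S\subseteq I$, by: $S\in K_f$ iff $\bigcap_{i\in S}\mathcal{W}_f(i)\neq\emptyset$ (for $S=\emptyset$ the intersection is $J$). A complex $K$ over $I$ generates a language $L\subseteq A^I$ if there exist finite sets $B,J$ and a function $f:B^J\to A^I$ with image exactly $L$ and $K_f\subseteq K$. A complex generating $L$ is minimal if no complex strictly contained in it generates $L$. We identify $\{0,1\}^V$ with the powerset $2^V$ (a binary sequence is the characteristic function of a subset of $V$), so $L\subseteq 2^V$ is a language over the alphabet $\{0,1\}$. $L\subseteq 2^V$ is upwards closed if $U\in L$ and $U\subseteq U'\subseteq V$ imply $U'\in L$. The $1$-skeleton of a complex over $V$ is the set of edges (two-element simplices) belonging to that complex, seen as a graph on vertex set $V$. A graph on $V$ is regarded as a complex whose simplices are its vertices and edges (and the empty set). A graph is connected if its vertex set cannot be partitioned into two non-empty parts with no edge between them. A graph $G$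 on vertex set $V$ is $L$-connected if for every inclusion-maximal set $W\subseteq V$ with $W\notin L$, removing the vertices of $W$ from $G$ results in a connected graph.
   Formalization: In the "if" direction and for minimality, complexes on V must contain every vertex of V and the empty simplex; for arbitrary subset-closed families the claim fails (L = 2^V with V nonempty and complex {∅}: its 1-skeleton is vacuously L-connected, but it generates only constant maps). *)

theory Defs
  imports "HOL-Library.FuncSet"
begin

text \<open>The set \<open>B\<^sup>J\<close> is the extensional function space \<open>J \<rightarrow>\<^sub>E B\<close>; hence a language over an
  alphabet with index set \<open>I\<close> is a set of functions that are \<open>undefined\<close> outside \<open>I\<close>.\<close>

definition determines ::
    "'j set \<Rightarrow> 'b set \<Rightarrow> (('j \<Rightarrow> 'b) \<Rightarrow> ('i \<Rightarrow> 'a)) \<Rightarrow> 'i \<Rightarrow> 'j set \<Rightarrow> bool" where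
  "determines J B f i W \<longleftrightarrow> W \<subseteq> J \<and>
     (\<forall>x \<in> J \<rightarrow>\<^sub>E B. \<forall>y \<in> J \<rightarrow>\<^sub>E B. restrict x W = restrict y W \<longrightarrow> f x i = f y i)"

definition input_window ::
    "'j set \<Rightarrow> 'b set \<Rightarrow> (('j \<Rightarrow> 'b) \<Rightarrow> ('i \<Rightarrow> 'a)) \<Rightarrow> 'i \<Rightarrow> 'j set" where
  "input_window J B f i = (LEAST W. determines J B f i W)"

lemma determines_Int:
  assumes "determines J B f i W1" "determines J B f i W2"
  shows "determines J B f i (W1 \<inter> W2)"
  unfolding determines_def
proof (intro conjI ballI impI)
  show "W1 \<inter> W2 \<subseteq> J" using assms unfolding determines_def by blast
next
  fix x y assume x: "x \<in> J \<rightarrow>\<^sub>E B" and y: "y \<in> J \<rightarrow>\<^sub>E B"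
    and eq: "restrict x (W1 \<inter> W2) = restrict y (W1 \<inter> W2)"
  define z where "z = (\<lambda>j. if j \<in> W1 then x j else y j)"
  have sub: "W1 \<subseteq> J" "W2 \<subseteq> J" using assms unfolding determines_def by blast+
  have agree: "x j = y j" if "j \<in> W1" "j \<in> W2" for j
    using fun_cong[OF eq, of j] that by simp
  have z: "z \<in> J \<rightarrow>\<^sub>E B"
    using x y sub by (auto simp: z_def PiE_iff extensional_def)
  have "restrict x W1 = restrict z W1"
    by (auto simp: z_def restrict_def fun_eq_iff)
  then have "f x i = f z i"
    using assms(1) x z unfolding determines_def by blast
  moreover have "restrict z W2 = restrict y W2"
    using agree by (auto simp: z_def restrict_def fun_eq_iff)
  then have "f z i = f y i"
    using assms(2) z y unfolding determines_def by blast
  ultimately show "f x i = f y i" by simp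
qed

lemma input_window_exists:
  assumes "finite J"
  shows "determines J B f i (input_window J B f i)"
    and "determines J B f i W \<Longrightarrow> input_window J B f i \<subseteq> W"
proof -
  have "determines J B f i J"
    by (simp add: determines_def)
  then obtain M where M: "determines J B f i M"
    and min: "\<And>W. determines J B f i W \<Longrightarrow> card M \<le> card W"
    using ex_has_least_nat[of "determines J B f i" J card] by blast
  have least: "M \<subseteq> W" if "determines J B f i W" for W
  proof -
    have "card M \<le> card (M \<inter> W)" using determines_Int[OF M that] min by blast
    moreover have "finite M" using M assms finite_subset unfolding determines_def by blast
    ultimately have "M \<inter> W = M" by (intro card_seteq) auto
    then show ?thesis by blast
  qed
  have eq: "input_window J B f i = M"
    unfolding input_window_def using M least by (intro Least_equality) auto
  show "determines J B f i (input_window J B f i)" using M eq by simp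
  show "determines J B f i W \<Longrightarrow> input_window J B f i \<subseteq> W" using least eq by simp
qed

text \<open>As a bare subset-closed family, a complex over \<open>I\<close> may be empty and need not contain all
  singletons.\<close>

definition complex_over :: "'i set \<Rightarrow> 'i set set \<Rightarrow> bool" where
  "complex_over I K \<longleftrightarrow> K \<subseteq> Pow I \<and> (\<forall>S \<in> K. \<forall>T. T \<subseteq> S \<longrightarrow> T \<in> K)"

text \<open>Complexes over \<open>I\<close> whose vertices are exactly the elements of \<open>I\<close>. The condition
  \<open>{} \<in> K\<close> matters only for \<open>I = {}\<close>. Graphs regarded as complexes are of this form.
  A family lacking the singleton \<open>{i}\<close> generates only languages that are constant at \<open>i\<close>,
  which is not visible in its 1-skeleton.\<close>

definition spanning_complex :: "'i set \<Rightarrow> 'i set set \<Rightarrow> bool" where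
  "spanning_complex I K \<longleftrightarrow> complex_over I K \<and> {} \<in> K \<and> (\<forall>i \<in> I. {i} \<in> K)"

text \<open>Intersecting with \<open>J\<close> implements the convention that the empty intersection is \<open>J\<close>.\<close>

definition communication_complex ::
    "'i set \<Rightarrow> 'j set \<Rightarrow> 'b set \<Rightarrow> (('j \<Rightarrow> 'b) \<Rightarrow> ('i \<Rightarrow> 'a)) \<Rightarrow> 'i set set" where
  "communication_complex I J B f =
     {S. S \<subseteq> I \<and> J \<inter> (\<Inter>i \<in> S. input_window J B f i) \<noteq> {}}"

text \<open>Every finite set is in bijection with a finite set of natural numbers, so taking \<open>J\<close> and
  \<open>B\<close> of type \<open>nat set\<close> is no restriction. For \<open>L \<subseteq> I \<rightarrow>\<^sub>E A\<close>, the image condition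
  makes \<open>f\<close> a function from \<open>J \<rightarrow>\<^sub>E B\<close> to \<open>I \<rightarrow>\<^sub>E A\<close>.\<close>

definition generates :: "'i set \<Rightarrow> 'i set set \<Rightarrow> ('i \<Rightarrow> 'a) set \<Rightarrow> bool" where
  "generates I K L \<longleftrightarrow>
     (\<exists>(J :: nat set) (B :: nat set) f. finite J \<and> finite B \<and>
        f ` (J \<rightarrow>\<^sub>E B) = L \<and> communication_complex I J B f \<subseteq> K)"

definition minimal_generating :: "'i set \<Rightarrow> 'i set set \<Rightarrow> ('i \<Rightarrow> 'a) set \<Rightarrow> bool" where
  "minimal_generating I K L \<longleftrightarrow> spanning_complex I K \<and> generates I K L \<and>
     \<not> (\<exists>K'. spanning_complex I K' \<and> K' \<subset> K \<and> generates I K' L)"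

definition binary_language :: "'v set \<Rightarrow> 'v set set \<Rightarrow> ('v \<Rightarrow> bool) set" where
  "binary_language V L = (\<lambda>U. \<lambda>v\<in>V. v \<in> U) ` L"

definition upwards_closed :: "'v set \<Rightarrow> 'v set set \<Rightarrow> bool" where
  "upwards_closed V L \<longleftrightarrow> (\<forall>U U'. U \<in> L \<and> U \<subseteq> U' \<and> U' \<subseteq> V \<longrightarrow> U' \<in> L)"

text \<open>A graph on \<open>V\<close> is given by its set of edges, which are two-element subsets of \<open>V\<close>.\<close>

definition graph_on :: "'v set \<Rightarrow> 'v set set \<Rightarrow> bool" where
  "graph_on V E \<longleftrightarrow> (\<forall>e \<in> E. e \<subseteq> V \<and> card e = 2)"

definition one_skeleton :: "'v set set \<Rightarrow> 'v set set" where
  "one_skeleton K = {e \<in> K. card e = 2}"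

definition graph_complex :: "'v set \<Rightarrow> 'v set set \<Rightarrow> 'v set set" where
  "graph_complex V E = {{}} \<union> {{v} | v. v \<in> V} \<union> E"

text \<open>The graph without vertices is connected.\<close>

definition graph_connected :: "'v set \<Rightarrow> 'v set set \<Rightarrow> bool" where
  "graph_connected V E \<longleftrightarrow>
     \<not> (\<exists>P Q. P \<noteq> {} \<and> Q \<noteq> {} \<and> P \<inter> Q = {} \<and> P \<union> Q = V \<and>
             (\<forall>p \<in> P. \<forall>q \<in> Q. {p, q} \<notin> E))"

definition maximal_nonmember :: "'v set \<Rightarrow> 'v set set \<Rightarrow> 'v set \<Rightarrow> bool" where
  "maximal_nonmember V L W \<longleftrightarrow> W \<subseteq> V \<and> W \<notin> L \<and>
     \<not> (\<exists>W'. W' \<subseteq> V \<and> W' \<notin> L \<and> W \<subset> W')"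

definition L_connected :: "'v set \<Rightarrow> 'v set set \<Rightarrow> 'v set set \<Rightarrow> bool" where
  "L_connected V L E \<longleftrightarrow>
     (\<forall>W. maximal_nonmember V L W \<longrightarrow> graph_connected (V - W) {e \<in> E. e \<inter> W = {}})"

definition minimal_L_connected :: "'v set \<Rightarrow> 'v set set \<Rightarrow> 'v set set \<Rightarrow> bool" where
  "minimal_L_connected V L E \<longleftrightarrow> graph_on V E \<and> L_connected V L E \<and>
     \<not> (\<exists>E'. graph_on V E' \<and> E' \<subset> E \<and> L_connected V L E')"

end

theory Submission
  imports Defs
begin

text \<open>A set belongs to \<open>L\<close> iff it meets the complement \<open>C\<close> of every maximal non-member. If such a
  \<open>C\<close> splits into two parts with disjoint input windows, then an input producing no ones in one
  part can be glued to an input producing no ones in the other, and the output misses \<open>C\<close>.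
  Conversely, fix a spanning tree of each \<open>C\<close>. Every orientation of a tree has a sink, and the
  edges can be oriented such that a given vertex is the only sink. So let the inputs orient, for
  every \<open>C\<close>, the edges of its tree, and let each vertex output 1 if it is a sink in some tree, or if
  a private input tells it to: the possible outputs are exactly the members of \<open>L\<close>.\<close>

section \<open>Generation with arbitrary index types and overestimated windows\<close>

text \<open>Serves to build generating functions without coding coordinates as numbers or computing
  exact windows. Any determining set \<open>w i\<close> contains the input window, so replacing
  windows by the sets \<open>w i\<close> can only add simplices to the communication
  complex.\<close>

lemma generatesI:
  fixes f :: "('j \<Rightarrow> 'b) \<Rightarrow> ('i \<Rightarrow> 'a)"
  assumes fin: "finite J" "finite B"
    and image: "f ` (J \<rightarrow>\<^sub>E B) = L"
    and w: "\<And>i. i \<in> I \<Longrightarrow> determines J B f i (w i)"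
    and K: "\<And>S j. S \<subseteq> I \<Longrightarrow> j \<in> J \<Longrightarrow> (\<And>i. i \<in> S \<Longrightarrow> j \<in> w i) \<Longrightarrow> S \<in> K"
  shows "generates I K L"
proof -
  obtain g :: "'j \<Rightarrow> nat" where g: "inj_on g J"
    using fin(1) finite_imp_inj_to_nat_seg by blast
  obtain h :: "'b \<Rightarrow> nat" where h: "inj_on h B"
    using fin(2) finite_imp_inj_to_nat_seg by blast
  \<comment> \<open>\<open>d\<close> decodes a numerical input into an original one. It maps onto
    all original inputs, so composing \<open>f\<close> with it keeps the image.\<close>
  define d where "d y = (\<lambda>j\<in>J. inv_into B h (y (g j)))" for y :: "nat \<Rightarrow> nat"
  let ?J = "g ` J" and ?B = "h ` B" and ?f = "\<lambda>y. f (d y)"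
  have d: "d y \<in> J \<rightarrow>\<^sub>E B" if "y \<in> ?J \<rightarrow>\<^sub>E ?B" for y
    using that by (auto simp: d_def intro!: inv_into_into)
  have "x \<in> d ` (?J \<rightarrow>\<^sub>E ?B)" if x: "x \<in> J \<rightarrow>\<^sub>E B" for x
  proof (rule image_eqI)
    let ?y = "\<lambda>k\<in>?J. h (x (inv_into J g k))"
    show "?y \<in> ?J \<rightarrow>\<^sub>E ?B"
      using x g by auto
    show "x = d ?y"
    proof
      fix j
      show "x j = d ?y j"
        using x g h by (cases "j \<in> J") (auto simp: d_def PiE_iff extensional_def)
    qed
  qed
  then have "d ` (?J \<rightarrow>\<^sub>E ?B) = J \<rightarrow>\<^sub>E B"
    using d by blast
  then have "?f ` (?J \<rightarrow>\<^sub>E ?B) = L"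
    using image by (metis image_image)
  moreover have "communication_complex I ?J ?B ?f \<subseteq> K"
  proof
    fix S assume S: "S \<in> communication_complex I ?J ?B ?f"
    then obtain j where j: "j \<in> J" and win: "\<And>i. i \<in> S \<Longrightarrow> g j \<in> input_window ?J ?B ?f i"
      unfolding communication_complex_def by blast
    have SI: "S \<subseteq> I"
      using S unfolding communication_complex_def by blast
    have "j \<in> w i" if i: "i \<in> S" for i
    proof -
      have wi: "determines J B f i (w i)"
        using w SI i by blast
      then have sub: "w i \<subseteq> J"
        unfolding determines_def by blast
      \<comment> \<open>The image of \<open>w i\<close> under \<open>g\<close> determines the
        decoded output at \<open>i\<close>, so it contains the new window; injectivity of
        \<open>g\<close> then carries membership back to \<open>w i\<close>.\<close>
      have "determines ?J ?B ?f i (g ` w i)"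
        unfolding determines_def
      proof (intro conjI ballI impI)
        show "g ` w i \<subseteq> ?J"
          using sub by blast
        fix x y assume x: "x \<in> ?J \<rightarrow>\<^sub>E ?B" and y: "y \<in> ?J \<rightarrow>\<^sub>E ?B"
          and eq: "restrict x (g ` w i) = restrict y (g ` w i)"
        have "x (g k) = y (g k)" if "k \<in> w i" for k
          using fun_cong[OF eq, of "g k"] that by simp
        then have "restrict (d x) (w i) = restrict (d y) (w i)"
          by (auto simp: d_def restrict_def)
        then show "f (d x) i = f (d y) i"
          using wi d[OF x] d[OF y] unfolding determines_def by blast
      qed
      then have "input_window ?J ?B ?f i \<subseteq> g ` w i"
        using fin by (intro input_window_exists(2)) auto
      then obtain k where "k \<in> w i" "g j = g k"
        using win[OF i] by blast
      then show ?thesis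
        using g j sub by (metis inj_onD subsetD)
    qed
    then show "S \<in> K"
      using K[OF SI j] by blast
  qed
  ultimately show ?thesis
    unfolding generates_def using fin by (metis finite_imageI)
qed

section \<open>Necessity of connectivity\<close>

lemma generates_imp_L_connected:
  assumes up: "upwards_closed V L"
    and LV: "L \<subseteq> Pow V"
    and gen: "generates V K (binary_language V L)"
  shows "L_connected V L (one_skeleton K)"
  unfolding L_connected_def graph_connected_def
proof (intro allI impI notI, elim exE conjE)
  fix W P Q
  assume W: "maximal_nonmember V L W" and ne: "P \<noteq> {}" "Q \<noteq> {}" and disj: "P \<inter> Q = {}"
    and un: "P \<union> Q = V - W"
    and sep: "\<forall>p\<in>P. \<forall>q\<in>Q. {p, q} \<notin> {e \<in> one_skeleton K. e \<inter> W = {}}"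
  obtain J B :: "nat set" and f where J: "finite J"
    and image: "f ` (J \<rightarrow>\<^sub>E B) = binary_language V L"
    and KK: "communication_complex V J B f \<subseteq> K"
    using gen unfolding generates_def by blast
  define win where "win = input_window J B f"
  have win: "determines J B f i (win i)" for i
    unfolding win_def using J by (rule input_window_exists(1))
  have f_eq: "f x i = f y i"
    if "x \<in> J \<rightarrow>\<^sub>E B" "y \<in> J \<rightarrow>\<^sub>E B" "\<And>j. j \<in> win i \<Longrightarrow> x j = y j" for x y i
    using win[of i] that unfolding determines_def by (metis restrict_ext)
  have WV: "W \<subseteq> V" and WL: "W \<notin> L"
    and max: "\<And>W'. W' \<subseteq> V \<Longrightarrow> W \<subset> W' \<Longrightarrow> W' \<in> L"
    using W unfolding maximal_nonmember_def by blast+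
  \<comment> \<open>By maximality of \<open>W\<close> both enlargements are outputs. The first gives
    an input \<open>x\<close> producing zeros on \<open>Q\<close>, the second an input
    \<open>y\<close> producing zeros on \<open>P\<close>.\<close>
  have "W \<union> P \<in> L" "W \<union> Q \<in> L"
    using ne un WV by (auto intro!: max)
  then have "(\<lambda>v\<in>V. v \<in> W \<union> P) \<in> f ` (J \<rightarrow>\<^sub>E B)" "(\<lambda>v\<in>V. v \<in> W \<union> Q) \<in> f ` (J \<rightarrow>\<^sub>E B)"
    unfolding image binary_language_def by blast+
  then obtain x y where x: "x \<in> J \<rightarrow>\<^sub>E B" "f x = (\<lambda>v\<in>V. v \<in> W \<union> P)"
    and y: "y \<in> J \<rightarrow>\<^sub>E B" "f y = (\<lambda>v\<in>V. v \<in> W \<union> Q)"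
    by (elim imageE) simp
  have win_disj: "win p \<inter> win q = {}" if pq: "p \<in> P" "q \<in> Q" for p q
  \<comment> \<open>A common coordinate would make \<open>{p, q}\<close> an edge of the 1-skeleton
    of \<open>K\<close> that avoids \<open>W\<close>, against \<open>sep\<close>.\<close>
  proof (rule ccontr)
    assume "win p \<inter> win q \<noteq> {}"
    moreover have "win p \<subseteq> J"
      using win unfolding determines_def by blast
    ultimately have "{p, q} \<in> communication_complex V J B f"
      using pq un unfolding communication_complex_def win_def by auto
    moreover have "card {p, q} = 2"
      using pq disj by (metis card_2_iff disjoint_iff)
    ultimately show False
      using sep pq un KK unfolding one_skeleton_def by blast
  qed
  \<comment> \<open>The glued input follows \<open>y\<close> on the windows of \<open>P\<close> and
    hence, by disjointness, \<open>x\<close> on those of \<open>Q\<close>. Its output vanishes on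
    \<open>P\<close> and on \<open>Q\<close>, so it lies below \<open>W\<close>, and upward closure
    would put \<open>W\<close> into \<open>L\<close>.\<close>
  define z where "z j = (if j \<in> (\<Union>p\<in>P. win p) then y j else x j)" for j
  have z: "z \<in> J \<rightarrow>\<^sub>E B"
    using x(1) y(1) by (auto simp: z_def PiE_iff extensional_def)
  have "\<not> f z v" if "v \<in> P" for v
  proof -
    have "f z v = f y v"
      using that by (intro f_eq z y) (auto simp: z_def)
    then show ?thesis
      using that un disj y(2) by auto
  qed
  moreover have "\<not> f z v" if "v \<in> Q" for v
  proof -
    have "f z v = f x v"
      using that win_disj by (intro f_eq z x) (auto simp: z_def)
    then show ?thesis
      using that un disj x(2) by auto
  qed
  moreover obtain U where U: "U \<in> L" "f z = (\<lambda>v\<in>V. v \<in> U)"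
    using z image unfolding binary_language_def by blast
  ultimately have "U \<subseteq> W"
    using un LV by fastforce
  then show False
    using up U(1) WV WL unfolding upwards_closed_def by blast
qed

section \<open>Orientations of spanning trees\<close>

text \<open>\<open>T\<close> plays the role of a spanning tree of \<open>S\<close>. An edge \<open>e\<close> points away from its endpoint \<open>v\<close>
  if its label \<open>a e\<close> is \<open>e - {v}\<close>; it may also carry a meaningless label, and then it points away
  from neither endpoint.\<close>

definition orientable_tree :: "'v set \<Rightarrow> 'v set set \<Rightarrow> bool" where
  "orientable_tree S T \<longleftrightarrow> T \<subseteq> Pow S \<and>
     (\<forall>a. \<exists>v\<in>S. \<forall>e\<in>T. v \<in> e \<longrightarrow> a e \<noteq> e - {v}) \<and>
     (\<forall>u\<in>S. \<exists>a. \<forall>v\<in>S. v \<noteq> u \<longrightarrow> (\<exists>e\<in>T. v \<in> e \<and> a e = e - {v}))"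

lemma orientable_treeD:
  assumes "orientable_tree S T"
  shows orientable_tree_subset: "T \<subseteq> Pow S"
    and orientable_tree_sink: "\<exists>v\<in>S. \<forall>e\<in>T. v \<in> e \<longrightarrow> a e \<noteq> e - {v}"
    and orientable_tree_orient:
      "u \<in> S \<Longrightarrow> \<exists>a. \<forall>v\<in>S. v \<noteq> u \<longrightarrow> (\<exists>e\<in>T. v \<in> e \<and> a e = e - {v})"
proof -
  note tree = assms[unfolded orientable_tree_def]
  show "T \<subseteq> Pow S"
    using tree by (rule conjunct1)
  show "\<exists>v\<in>S. \<forall>e\<in>T. v \<in> e \<longrightarrow> a e \<noteq> e - {v}"
    using tree by (elim conjE) (erule spec)
  show "u \<in> S \<Longrightarrow> \<exists>a. \<forall>v\<in>S. v \<noteq> u \<longrightarrow> (\<exists>e\<in>T. v \<in> e \<and> a e = e - {v})"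
    using tree by (elim conjE) (erule bspec)
qed

text \<open>Attaches a leaf \<open>q\<close> at \<open>p\<close>. If the new edge points from
  \<open>q\<close> to \<open>p\<close>, a sink of the old tree remains one; otherwise
  \<open>q\<close> itself is a sink, as this is its only edge. To make \<open>q\<close> the only
  sink, orient the old tree towards \<open>p\<close> and the new edge towards \<open>q\<close>; for
  an old target, keep its orientation and point the new edge at \<open>p\<close>.\<close>

lemma orientable_tree_insert:
  assumes T: "orientable_tree S T" and p: "p \<in> S" and q: "q \<notin> S"
  shows "orientable_tree (insert q S) (insert {p, q} T)"
proof -
  let ?e = "{p, q}"
  note sub = orientable_tree_subset[OF T]
    and sink = orientable_tree_sink[OF T]
    and orient = orientable_tree_orient[OF T]
  have pq: "p \<noteq> q" and qT: "\<And>e. e \<in> T \<Longrightarrow> q \<notin> e" and eT: "?e \<notin> T"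
    using p q sub by auto
  have diff: "?e - {p} = {q}" "?e - {q} = {p}"
    using pq by auto
  show ?thesis
    unfolding orientable_tree_def
  proof (intro conjI allI ballI)
    show "insert ?e T \<subseteq> Pow (insert q S)"
      using sub p by blast
  next
    fix a :: "'a set \<Rightarrow> 'a set"
    show "\<exists>v\<in>insert q S. \<forall>e\<in>insert ?e T. v \<in> e \<longrightarrow> a e \<noteq> e - {v}"
    proof (cases "a ?e = {p}")
      case True
      obtain v where v: "v \<in> S" "\<forall>e\<in>T. v \<in> e \<longrightarrow> a e \<noteq> e - {v}"
        using sink by blast
      have "v \<in> ?e \<longrightarrow> a ?e \<noteq> ?e - {v}"
        using v(1) q True diff pq by auto
      then show ?thesis
        using v by blast
    next
      case False
      then show ?thesis
        using qT diff by (intro bexI[of _ q]) auto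
    qed
  next
    fix u assume u: "u \<in> insert q S"
    show "\<exists>a. \<forall>v\<in>insert q S. v \<noteq> u \<longrightarrow> (\<exists>e\<in>insert ?e T. v \<in> e \<and> a e = e - {v})"
    proof (cases "u = q")
      case True
      obtain a where a: "\<And>v. v \<in> S \<Longrightarrow> v \<noteq> p \<Longrightarrow> \<exists>e\<in>T. v \<in> e \<and> a e = e - {v}"
        using orient[OF p] by blast
      show ?thesis
      proof (intro exI[of _ "a(?e := {q})"] ballI impI)
        fix v assume v: "v \<in> insert q S" "v \<noteq> u"
        show "\<exists>e\<in>insert ?e T. v \<in> e \<and> (a(?e := {q})) e = e - {v}"
        proof (cases "v = p")
          case True
          then show ?thesis using diff by auto
        next
          case False
          then obtain e where "e \<in> T" "v \<in> e" "a e = e - {v}"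
            using a v \<open>u = q\<close> by blast
          then show ?thesis
            using eT by (intro bexI[of _ e]) auto
        qed
      qed
    next
      case False
      then have "u \<in> S"
        using u by blast
      then obtain a where a: "\<And>v. v \<in> S \<Longrightarrow> v \<noteq> u \<Longrightarrow> \<exists>e\<in>T. v \<in> e \<and> a e = e - {v}"
        using orient[of u] by blast
      show ?thesis
      proof (intro exI[of _ "a(?e := {p})"] ballI impI)
        fix v assume v: "v \<in> insert q S" "v \<noteq> u"
        show "\<exists>e\<in>insert ?e T. v \<in> e \<and> (a(?e := {p})) e = e - {v}"
        proof (cases "v = q")
          case True
          then show ?thesis using diff by auto
        next
          case False
          then obtain e where "e \<in> T" "v \<in> e" "a e = e - {v}"
            using a v by blast
          then show ?thesis
            using eT by (intro bexI[of _ e]) auto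
        qed
      qed
    qed
  qed
qed

text \<open>Grow a tree from a single vertex: if a maximal vertex set carrying a tree were not all
  of \<open>C\<close>, connectivity would supply an edge leaving it, which could be
  attached.\<close>

lemma graph_connected_imp_orientable_tree:
  assumes fin: "finite C" and ne: "C \<noteq> {}" and conn: "graph_connected C E"
  shows "\<exists>T\<subseteq>E. orientable_tree C T"
proof -
  let ?Q = "\<lambda>S. S \<subseteq> C \<and> S \<noteq> {} \<and> (\<exists>T\<subseteq>E. orientable_tree S T)"
  obtain r where r: "r \<in> C"
    using ne by blast
  have "orientable_tree {r} {}"
    unfolding orientable_tree_def by simp
  then have "?Q {r}"
    using r by blast
  moreover have "finite {S. ?Q S}"
    using fin by (auto intro: finite_subset[of _ "Pow C"])
  ultimately have "\<exists>S\<in>{S. ?Q S}. \<forall>S'\<in>{S. ?Q S}. S \<subseteq> S' \<longrightarrow> S = S'"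
    by (intro finite_has_maximal) auto
  then obtain S where S: "?Q S" and max: "\<And>S'. ?Q S' \<Longrightarrow> S \<subseteq> S' \<Longrightarrow> S = S'"
    unfolding Bex_def Ball_def mem_Collect_eq by metis
  have "S = C"
  proof (rule ccontr)
    assume "S \<noteq> C"
    then have "C - S \<noteq> {}" "S \<inter> (C - S) = {}" "S \<union> (C - S) = C"
      using S by auto
    then have "\<not> (\<forall>p\<in>S. \<forall>q\<in>C - S. {p, q} \<notin> E)"
      using conn S unfolding graph_connected_def by meson
    then obtain p q where pq: "p \<in> S" "q \<in> C - S" "{p, q} \<in> E"
      by blast
    obtain T where "T \<subseteq> E" "orientable_tree S T"
      using S by blast
    then have "?Q (insert q S)"
      using orientable_tree_insert[of S T p q] pq S by blast
    then show False
      using max[of "insert q S"] pq by blast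
  qed
  then show ?thesis
    using S by blast
qed

section \<open>Sufficiency of connectivity\<close>

lemma nonmember_subset_maximal:
  assumes "finite V" "U \<subseteq> V" "U \<notin> L"
  shows "\<exists>W. maximal_nonmember V L W \<and> U \<subseteq> W"
proof -
  have "finite (Pow V - L)" "U \<in> Pow V - L"
    using assms by auto
  then obtain W where "W \<in> Pow V - L" "U \<subseteq> W" "\<forall>W'\<in>Pow V - L. W \<subseteq> W' \<longrightarrow> W = W'"
    using finite_has_maximal2 by metis
  then show ?thesis
    unfolding maximal_nonmember_def by (intro exI[of _ W]) auto
qed

lemma L_connected_imp_generates:
  assumes fin: "finite V"
    and LV: "L \<subseteq> Pow V"
    and up: "upwards_closed V L"
    and K: "spanning_complex V K"
    and conn: "L_connected V L (one_skeleton K)"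
  shows "generates V K (binary_language V L)"
proof (cases "L = {}")
  case True
  have "{} \<in> K"
    using K unfolding spanning_complex_def by blast
  \<comment> \<open>An empty alphabet with a non-empty index set admits no input, so the image is
    empty. With empty windows, only the simplex \<open>{}\<close> has to lie in
    \<open>K\<close>.\<close>
  then show ?thesis
    by (intro generatesI[where J = "{()}" and B = "{} :: unit set" and w = "\<lambda>_. {}"])
      (auto simp: True binary_language_def determines_def intro: back_subst[of "\<lambda>S. S \<in> K" "{}"])
next
  case False
  then have VL: "V \<in> L"
    using up LV unfolding upwards_closed_def by blast
  have KV: "K \<subseteq> Pow V" and Kdown: "\<And>S T. S \<in> K \<Longrightarrow> T \<subseteq> S \<Longrightarrow> T \<in> K"
    and K1: "\<And>v. v \<in> V \<Longrightarrow> {v} \<in> K"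
    using K unfolding spanning_complex_def complex_over_def by blast+
  define CC where "CC = {V - W | W. maximal_nonmember V L W}"
  have "\<exists>T\<subseteq>one_skeleton K. orientable_tree C T" if C: "C \<in> CC" for C
  proof -
    obtain W where W: "maximal_nonmember V L W" "C = V - W"
      using C unfolding CC_def by blast
    then have "W \<subseteq> V" "W \<notin> L"
      unfolding maximal_nonmember_def by auto
    \<comment> \<open>Needed because a tree without vertices has no sink.\<close>
    then have "C \<noteq> {}"
      using VL W(2) by auto
    moreover have "graph_connected C {e \<in> one_skeleton K. e \<inter> W = {}}"
      using conn W unfolding L_connected_def by blast
    moreover have "finite C"
      using fin W(2) by blast
    ultimately have "\<exists>T\<subseteq>{e \<in> one_skeleton K. e \<inter> W = {}}. orientable_tree C T"
      by (intro graph_connected_imp_orientable_tree)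
    then show ?thesis
      by (elim ex_forward conj_forward) auto
  qed
  then have "\<forall>C\<in>CC. \<exists>T. T \<subseteq> one_skeleton K \<and> orientable_tree C T"
    by (intro ballI) simp
  from bchoice[OF this] obtain T where "\<forall>C\<in>CC. T C \<subseteq> one_skeleton K \<and> orientable_tree C (T C)" ..
  then have TK: "\<And>C. C \<in> CC \<Longrightarrow> T C \<subseteq> one_skeleton K"
    and T: "\<And>C. C \<in> CC \<Longrightarrow> orientable_tree C (T C)"
    by simp_all
  define J where "J = (K - {{}}) \<times> Pow V"
  \<comment> \<open>The coordinate \<open>({v}, {})\<close> is the private input of \<open>v\<close>; the coordinate \<open>(e, C)\<close> of an edge
    \<open>e\<close> orients \<open>e\<close> in the tree of \<open>C\<close>.\<close>
  define F where "F x = {v \<in> V. x ({v}, {}) = {v} \<or>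
      (\<exists>C\<in>CC. v \<in> C \<and> (\<forall>e\<in>T C. v \<in> e \<longrightarrow> x (e, C) \<noteq> e - {v}))}"
    for x :: "'a set \<times> 'a set \<Rightarrow> 'a set"
  define f where "f x = (\<lambda>v\<in>V. v \<in> F x)" for x
  \<comment> \<open>A vertex reads only coordinates whose first entry contains it. So the vertices
    sharing a coordinate lie in one simplex of \<open>K\<close>.\<close>
  define w where "w v = {(e, C) \<in> J. v \<in> e}" for v
  have CV: "C \<subseteq> V" if "C \<in> CC" for C
    using that unfolding CC_def by blast
  have TJ: "(e, C) \<in> J" if "C \<in> CC" "e \<in> T C" for e C
    using that TK CV unfolding J_def one_skeleton_def by fastforce
  \<comment> \<open>For arbitrary labels, the tree on the complement of a maximal non-member
    \<open>W\<close> above \<open>F x\<close> has a sink, which outputs 1 although it lies outside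
    \<open>W\<close>.\<close>
  have "F x \<in> L" for x
  proof (rule ccontr)
    assume "F x \<notin> L"
    moreover have "F x \<subseteq> V"
      unfolding F_def by blast
    ultimately obtain W where W: "maximal_nonmember V L W" "F x \<subseteq> W"
      using nonmember_subset_maximal fin by meson
    then have C: "V - W \<in> CC"
      unfolding CC_def by blast
    then obtain v where "v \<in> V - W" "\<forall>e\<in>T (V - W). v \<in> e \<longrightarrow> x (e, V - W) \<noteq> e - {v}"
      using orientable_tree_sink[OF T, of "V - W" "\<lambda>e. x (e, V - W)"] by blast
    then have "v \<in> F x"
      using C unfolding F_def by blast
    then show False
      using W(2) \<open>v \<in> V - W\<close> by blast
  qed
  moreover have "U \<in> F ` (J \<rightarrow>\<^sub>E Pow V)" if U: "U \<in> L" for U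
  proof -
    \<comment> \<open>If \<open>U\<close> missed \<open>C\<close>, it would lie in \<open>W\<close>,
      and upward closure would give \<open>W \<in> L\<close>. The chosen point \<open>u C\<close>
      becomes the intended sink of the tree of \<open>C\<close>.\<close>
    have "\<exists>u. u \<in> U \<inter> C" if C: "C \<in> CC" for C
    proof -
      obtain W where "maximal_nonmember V L W" "C = V - W"
        using C unfolding CC_def by blast
      moreover from this have "W \<subseteq> V" "W \<notin> L"
        unfolding maximal_nonmember_def by auto
      moreover from this have "\<not> U \<subseteq> W"
        using up U unfolding upwards_closed_def by auto
      ultimately show ?thesis
        using U LV by auto
    qed
    then have "\<forall>C\<in>CC. \<exists>u. u \<in> U \<inter> C" ..
    from bchoice[OF this] obtain u where "\<forall>C\<in>CC. u C \<in> U \<inter> C" ..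
    then have u: "\<And>C. C \<in> CC \<Longrightarrow> u C \<in> U" "\<And>C. C \<in> CC \<Longrightarrow> u C \<in> C"
      by simp_all
    have "\<forall>C\<in>CC. \<exists>a. \<forall>v\<in>C. v \<noteq> u C \<longrightarrow> (\<exists>e\<in>T C. v \<in> e \<and> a e = e - {v})"
      using orientable_tree_orient[OF T u(2)] by simp
    from bchoice[OF this] obtain a where a:
      "\<forall>C\<in>CC. \<forall>v\<in>C. v \<noteq> u C \<longrightarrow> (\<exists>e\<in>T C. v \<in> e \<and> a C e = e - {v})" ..
    \<comment> \<open>Size 1 marks the private inputs, which announce membership in
      \<open>U\<close>. Intersecting with \<open>V\<close> keeps labels inside the alphabet and
      leaves a label \<open>e - {v}\<close> of a tree edge unchanged, so every sink is some
      \<open>u C\<close> and hence in \<open>U\<close>.\<close>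
    define x where "x = (\<lambda>(e, C)\<in>J. if card e = 1 then e \<inter> U else a C e \<inter> V)"
    have x: "x \<in> J \<rightarrow>\<^sub>E Pow V"
      using subsetD[OF LV U] unfolding x_def by (auto split: if_splits)
    have own_input: "x ({v}, {}) = {v} \<longleftrightarrow> v \<in> U" if "v \<in> V" for v
      using that K1 by (auto simp: x_def J_def)
    have sink_in: "v \<in> U" if v: "C \<in> CC" "v \<in> C" "\<forall>e\<in>T C. v \<in> e \<longrightarrow> x (e, C) \<noteq> e - {v}" for C v
    proof (cases "v = u C")
      case False
      then obtain e where e: "e \<in> T C" "v \<in> e" "a C e = e - {v}"
        using a v by blast
      have "card e = 2" "e \<subseteq> V"
        using e(1) TK[OF v(1)] KV unfolding one_skeleton_def by auto
      then have "x (e, C) = e - {v}"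
        using TJ[OF v(1) e(1)] e(3) by (auto simp: x_def)
      then show ?thesis
        using v(3) e by blast
    qed (use u v in blast)
    have "F x = U"
    proof (intro subset_antisym subsetI)
      fix v assume "v \<in> F x"
      then show "v \<in> U"
        unfolding F_def mem_Collect_eq using own_input sink_in by (elim conjE disjE bexE) simp_all
    next
      fix v assume "v \<in> U"
      then show "v \<in> F x"
        unfolding F_def using own_input subsetD[OF LV U] by auto
    qed
    then show ?thesis
      using x by (rule image_eqI[OF sym])
  qed
  ultimately have "F ` (J \<rightarrow>\<^sub>E Pow V) = L"
    by blast
  then have "f ` (J \<rightarrow>\<^sub>E Pow V) = binary_language V L"
    unfolding f_def binary_language_def by (simp flip: image_image[of "\<lambda>U. \<lambda>v\<in>V. v \<in> U" F])
  moreover have "determines J (Pow V) f v (w v)" if v: "v \<in> V" for v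
    unfolding determines_def
  proof (intro conjI ballI impI)
    show "w v \<subseteq> J"
      unfolding w_def by blast
    fix x y :: "'a set \<times> 'a set \<Rightarrow> 'a set"
    assume eq: "restrict x (w v) = restrict y (w v)"
    have agree: "x (e, C) = y (e, C)" if "(e, C) \<in> J" "v \<in> e" for e C
      using fun_cong[OF eq, of "(e, C)"] that by (simp add: w_def)
    have "({v}, {}) \<in> J"
      using K1 v unfolding J_def by blast
    then have "v \<in> F x \<longleftrightarrow> v \<in> F y"
      using agree TJ unfolding F_def by auto
    then show "f x v = f y v"
      unfolding f_def by simp
  qed
  moreover have "S \<in> K" if "j \<in> J" "\<And>v. v \<in> S \<Longrightarrow> j \<in> w v" for S j
  proof -
    obtain e C where j: "j = (e, C)"
      by (cases j)
    then have "S \<subseteq> e" "e \<in> K"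
      using that unfolding w_def J_def by auto
    then show ?thesis
      using Kdown by blast
  qed
  moreover have "finite J"
    using fin KV finite_subset unfolding J_def by blast
  ultimately show ?thesis
    using fin by (intro generatesI[where J = J and B = "Pow V" and f = f and w = w]) auto
qed

section \<open>Graphs as complexes, and minimality\<close>

lemma one_skeleton_graph_complex:
  assumes "graph_on V E"
  shows "one_skeleton (graph_complex V E) = E"
  using assms by (auto simp: one_skeleton_def graph_complex_def graph_on_def)

lemma spanning_graph_complex:
  assumes "graph_on V E"
  shows "spanning_complex V (graph_complex V E)"
  unfolding spanning_complex_def complex_over_def
proof (intro conjI ballI allI impI)
  show "graph_complex V E \<subseteq> Pow V"
    using assms by (auto simp: graph_complex_def graph_on_def)
  show "{} \<in> graph_complex V E" and "\<And>v. v \<in> V \<Longrightarrow> {v} \<in> graph_complex V E"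
    by (auto simp: graph_complex_def)
  fix S T assume S: "S \<in> graph_complex V E" and TS: "T \<subseteq> S"
  then consider "S = {}" | v where "v \<in> V" "S = {v}" | "S \<in> E"
    by (auto simp: graph_complex_def)
  then show "T \<in> graph_complex V E"
  proof cases
    case 3
    then have "S \<subseteq> V" "card S = 2"
      using assms by (auto simp: graph_on_def)
    then obtain p q where pq: "S = {p, q}" "p \<in> V" "q \<in> V"
      by (auto simp: card_2_iff)
    then have "T = {} \<or> T = {p} \<or> T = {q} \<or> T = S"
      using TS by blast
    then show ?thesis
      using S pq by (auto simp: graph_complex_def)
  qed (use S TS in \<open>auto simp: graph_complex_def subset_singleton_iff\<close>)
qed

lemma graph_on_one_skeleton:
  assumes "complex_over V K"
  shows "graph_on V (one_skeleton K)"
  using assms by (auto simp: complex_over_def graph_on_def one_skeleton_def)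

lemma graph_complex_one_skeleton_subset:
  assumes "spanning_complex V K"
  shows "graph_complex V (one_skeleton K) \<subseteq> K"
  using assms by (auto simp: spanning_complex_def graph_complex_def one_skeleton_def)

theorem theorem3p1:
  fixes V :: "'v set" and L :: "'v set set"
  assumes "finite V" and "L \<subseteq> Pow V" and "upwards_closed V L"
  shows "(\<forall>K. complex_over V K \<longrightarrow> generates V K (binary_language V L) \<longrightarrow>
              L_connected V L (one_skeleton K)) \<and>
         (\<forall>K. spanning_complex V K \<longrightarrow>
              (generates V K (binary_language V L) \<longleftrightarrow> L_connected V L (one_skeleton K))) \<and>
         {K. minimal_generating V K (binary_language V L)} =
           graph_complex V ` {E. minimal_L_connected V L E}"
proof (intro conjI allI impI)
  show "L_connected V L (one_skeleton K)" if "generates V K (binary_language V L)" for K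
    using generates_imp_L_connected assms that by blast
  show gen_iff: "generates V K (binary_language V L) \<longleftrightarrow> L_connected V L (one_skeleton K)"
    if "spanning_complex V K" for K
    using generates_imp_L_connected L_connected_imp_generates assms that by blast
  have gen_graph: "generates V (graph_complex V E) (binary_language V L) \<longleftrightarrow> L_connected V L E"
    if "graph_on V E" for E
    using gen_iff[OF spanning_graph_complex[OF that]] one_skeleton_graph_complex[OF that] by simp
  show "{K. minimal_generating V K (binary_language V L)} =
      graph_complex V ` {E. minimal_L_connected V L E}"
  proof (intro subset_antisym subsetI)
    fix K assume "K \<in> {K. minimal_generating V K (binary_language V L)}"
    then have K: "spanning_complex V K" "generates V K (binary_language V L)"
      and min: "\<And>K'. spanning_complex V K' \<Longrightarrow> generates V K' (binary_language V L) \<Longrightarrow> \<not> K' \<subset> K"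
      unfolding minimal_generating_def by blast+
    let ?E = "one_skeleton K"
    have E: "graph_on V ?E" "L_connected V L ?E"
      using K gen_iff graph_on_one_skeleton unfolding spanning_complex_def by blast+
    \<comment> \<open>The graph complex of the 1-skeleton lies in \<open>K\<close> and has the same
      1-skeleton, so it generates the language too; minimality forces equality.\<close>
    then have K_eq: "K = graph_complex V ?E"
      using min[of "graph_complex V ?E"] spanning_graph_complex gen_graph
        graph_complex_one_skeleton_subset[OF K(1)] by blast
    have "\<not> L_connected V L E'" if E': "graph_on V E'" "E' \<subset> ?E" for E'
    proof
      assume "L_connected V L E'"
      then have "\<not> graph_complex V E' \<subset> K"
        using min spanning_graph_complex gen_graph E'(1) by blast
      moreover have "graph_complex V E' \<subseteq> K"
        using E'(2) unfolding graph_complex_def by (subst K_eq) (auto simp: graph_complex_def)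
      moreover have "graph_complex V E' \<noteq> K"
        using E' one_skeleton_graph_complex by blast
      ultimately show False
        by blast
    qed
    then have "minimal_L_connected V L ?E"
      using E unfolding minimal_L_connected_def by blast
    then show "K \<in> graph_complex V ` {E. minimal_L_connected V L E}"
      using K_eq by blast
  next
    fix K assume "K \<in> graph_complex V ` {E. minimal_L_connected V L E}"
    then obtain E where K_eq: "K = graph_complex V E" and E: "graph_on V E" "L_connected V L E"
      and min: "\<And>E'. graph_on V E' \<Longrightarrow> L_connected V L E' \<Longrightarrow> \<not> E' \<subset> E"
      unfolding minimal_L_connected_def by blast
    have "\<not> generates V K' (binary_language V L)" if K': "spanning_complex V K'" "K' \<subset> K" for K'
    proof
      assume "generates V K' (binary_language V L)"
      then have "\<not> one_skeleton K' \<subset> E"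
        using min K'(1) gen_iff graph_on_one_skeleton unfolding spanning_complex_def by blast
      moreover have "one_skeleton K' \<subseteq> one_skeleton K"
        using K'(2) unfolding one_skeleton_def by blast
      \<comment> \<open>Minimality of \<open>E\<close> leaves no room for a smaller 1-skeleton. As
        \<open>K'\<close> contains the graph complex of its own 1-skeleton, it then contains
        \<open>K\<close>, contrary to strict inclusion.\<close>
      ultimately have "one_skeleton K' = E"
        using one_skeleton_graph_complex[OF E(1)] K_eq by blast
      then show False
        using graph_complex_one_skeleton_subset[OF K'(1)] K'(2) K_eq by blast
    qed
    then show "K \<in> {K. minimal_generating V K (binary_language V L)}"
      using E K_eq spanning_graph_complex gen_graph unfolding minimal_generating_def by blast
  qed
qed

end
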